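(* Let $v$ be even, let $X$ be a set of $v$ points partitioned into two parts $X_1,X_2$ of size $n=v/2$, let $k\ge 4$ be even with $n\ge k$, and let $h=k/2$. Suppose that on $X_1$ there is a resolvable $(n,h,2)$ covering design with parallel classes $\mathcal{P}_1,\ldots,\mathcal{P}_p$ and on $X_2$ a resolvable $(n,h,2)$ covering design with parallel classes $\mathcal{R}_1,\ldots,\mathcal{R}_p$, where each parallel class consists of exactly $2$ blocks. For $i=1,2$ let $(X_i,\mathcal{B}_i)$ be an $(n,k,4)$ covering design. Define $$\mathcal{B}=\mathcal{B}_1\cup\mathcal{B}_2\cup\bigcup_{i=1}^p\mathcal{P}_i\mathcal{R}_i.$$ Then $(X,\mathcal{B})$ is a $(v,k,4,5)$ cover.
   Context: A $(v,k,t,m)$ cover is a pair $(X,\mathcal{B})$ with $|X|=v$ and $\mathcal{B}$ a collection of $k$-subsets of $X$ such that every $m$-subset of $X$ meets some block in at least $t$ points; a $(v,k,t)$ covering design is a $(v,k,t,t)$ cover (every $t$-subset lies in some block). A $(v,k,t)$ covering design is resolvable if its blocks can be partitioned into parallel classes, each of which is a partition of the point set. For collections $\mathcal{A},\mathcal{B}$, $\mathcal{A}\mathcal{B}=\{A\cup B: A\in\mathcal{A},B\in\mathcal{B}\}$. *)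

theory Defs
  imports Main "HOL-Library.Disjoint_Sets"
begin

definition cover :: "nat \<Rightarrow> nat \<Rightarrow> nat \<Rightarrow> nat \<Rightarrow> 'a set \<Rightarrow> 'a set set \<Rightarrow> bool" where
  "cover v k t m X \<B> \<longleftrightarrow>
     finite X \<and> card X = v \<and>
     (\<forall>b\<in>\<B>. b \<subseteq> X \<and> card b = k) \<and>
     (\<forall>M. M \<subseteq> X \<and> card M = m \<longrightarrow> (\<exists>b\<in>\<B>. t \<le> card (M \<inter> b)))"

definition covering_design :: "nat \<Rightarrow> nat \<Rightarrow> nat \<Rightarrow> 'a set \<Rightarrow> 'a set set \<Rightarrow> bool" where
  "covering_design v k t X \<B> \<longleftrightarrow> cover v k t t X \<B>"

text \<open>A resolution \<open>\<C>\<close> partitions the block set into parallel classes;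
  the design is resolvable if a resolution exists.\<close>

definition resolution :: "'a set \<Rightarrow> 'a set set \<Rightarrow> 'a set set set \<Rightarrow> bool" where
  "resolution X \<B> \<C> \<longleftrightarrow> partition_on \<B> \<C> \<and> (\<forall>P\<in>\<C>. partition_on X P)"

definition join :: "'a set set \<Rightarrow> 'a set set \<Rightarrow> 'a set set" where
  "join \<A> \<B> = {A \<union> B |A B. A \<in> \<A> \<and> B \<in> \<B>}"

end

theory Submission
  imports Defs
begin

text \<open>A 5-set with at least four points in one half is handled by the covering design on that
  half. Otherwise it splits as 3 + 2: some parallel class has a block containing both points of the
  smaller part, and by pigeonhole one of the two blocks of the class joined with it contains two of
  the three points of the larger part.\<close>

lemma join_commute: "join \<A> \<B> = join \<B> \<A>"
  unfolding join_def by blast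

text \<open>The cover property speaks only of subsets of \<open>X\<close> with exactly
  \<open>m\<close> points. Any \<open>M\<close> with at least \<open>m\<close> points in
  \<open>X\<close> contains such a subset \<open>T\<close>, and passing from \<open>T\<close> back
  to \<open>M\<close> can only enlarge the intersection with a block.\<close>

lemma cover_meets_superset:
  assumes "cover v k t m X \<B>" "m \<le> card (M \<inter> X)"
  shows "\<exists>b\<in>\<B>. t \<le> card (M \<inter> b)"
proof -
  have fin: "finite X" and sub: "\<forall>b\<in>\<B>. b \<subseteq> X"
    using assms(1) by (auto simp: cover_def)
  obtain T where T: "T \<subseteq> M \<inter> X" "card T = m"
    using obtain_subset_with_card_n[OF assms(2)] by metis
  then obtain b where b: "b \<in> \<B>" "t \<le> card (T \<inter> b)"
    using assms(1) unfolding cover_def by (metis le_inf_iff)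
  have "card (T \<inter> b) \<le> card (M \<inter> b)"
  proof (rule card_mono)
    \<comment> \<open>\<open>M\<close> is arbitrary and may be infinite, so finiteness has to come
      from \<open>b\<close>, which lies in the finite set \<open>X\<close>.\<close>
    show "finite (M \<inter> b)"
      using b(1) sub fin by (meson finite_Int finite_subset)
  qed (use T in auto)
  with b show ?thesis by (meson order_trans)
qed

text \<open>The two blocks exhaust \<open>Y\<close>, so if each met \<open>M\<close> in at most
  \<open>c\<close> points, \<open>M\<close> would have at most \<open>2 * c\<close> points in
  \<open>Y\<close>.\<close>

lemma partition_two_pigeonhole:
  assumes "partition_on Y P" "card P = 2" "finite Y" "2 * c < card (M \<inter> Y)"
  shows "\<exists>A\<in>P. c < card (M \<inter> A)"
proof -
  obtain A A' where P: "P = {A, A'}"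
    using assms(2) by (auto simp: card_2_iff)
  have "M \<inter> Y = (M \<inter> A) \<union> (M \<inter> A')"
    using partition_onD1[OF assms(1)] P by auto
  then have "card (M \<inter> Y) \<le> card (M \<inter> A) + card (M \<inter> A')"
    by (metis card_Un_le)
  with assms(4) P show ?thesis by (cases "c < card (M \<inter> A)") auto
qed

lemma resolution_block_in_class:
  assumes "resolution X D (P ` I)" "A \<in> D"
  obtains i where "i \<in> I" "A \<in> P i"
  using assms unfolding resolution_def partition_on_def by blast

lemma resolution_class:
  assumes "resolution X D (P ` I)" "i \<in> I"
  shows "partition_on X (P i)" "P i \<subseteq> D"
  using assms unfolding resolution_def partition_on_def by blast+

text \<open>The halves are kept generic so that the splits 3 + 2 and 2 + 3 are both instances. The
  pair in \<open>Z\<close> dictates the index \<open>i\<close>; the triple in \<open>Y\<close> then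
  has to cope with whichever class \<open>P i\<close> results, which pigeonhole allows.\<close>

lemma join_block_meets_split:
  assumes design: "covering_design n h 2 Z D" and R: "resolution Z D (R ` I)"
    and P: "\<forall>i\<in>I. partition_on Y (P i) \<and> card (P i) = 2"
    and fin: "finite Y" and disj: "Y \<inter> Z = {}"
    and Y: "3 \<le> card (M \<inter> Y)" and Z: "2 \<le> card (M \<inter> Z)"
  shows "\<exists>i\<in>I. \<exists>b\<in>join (P i) (R i). 4 \<le> card (M \<inter> b)"
proof -
  have cov: "cover n h 2 2 Z D"
    using design by (simp add: covering_design_def)
  obtain C where C: "C \<in> D" "2 \<le> card (M \<inter> C)"
    using cover_meets_superset[OF cov Z] by blast
  obtain i where i: "i \<in> I" "C \<in> R i"
    using resolution_block_in_class[OF R C(1)] by blast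
  \<comment> \<open>Pigeonhole with \<open>c = 1\<close>: three points in two blocks put two in the
    same one.\<close>
  obtain A where A: "A \<in> P i" "1 < card (M \<inter> A)"
    using partition_two_pigeonhole[of Y "P i" 1 M] P i(1) fin Y by auto
  have sub: "A \<subseteq> Y" "C \<subseteq> Z"
    using partition_onD1[of Y "P i"] P i(1) A(1) C(1) cov by (auto simp: cover_def)
  moreover have "finite Z"
    using cov by (simp add: cover_def)
  ultimately have "finite A" "finite C" "A \<inter> C = {}"
    using fin disj by (auto intro: finite_subset)
  then have "card (M \<inter> (A \<union> C)) = card (M \<inter> A) + card (M \<inter> C)"
    unfolding Int_Un_distrib by (intro card_Un_disjoint) auto
  with A(2) C(2) have "4 \<le> card (M \<inter> (A \<union> C))" by simp
  moreover have "A \<union> C \<in> join (P i) (R i)"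
    using A(1) i(2) unfolding join_def by blast
  ultimately show ?thesis using i(1) by blast
qed

theorem theorem18:
  fixes X X1 X2 :: "'a set"
    and D1 D2 B1 B2 B :: "'a set set"
    and P R :: "nat \<Rightarrow> 'a set set"
    and v n k h p :: nat
  assumes "even v" and "n = v div 2"
    and "even k" and "k \<ge> 4" and "n \<ge> k" and "h = k div 2"
    and "finite X" and "card X = v"
    and "X = X1 \<union> X2" and "X1 \<inter> X2 = {}" and "card X1 = n" and "card X2 = n"
    and "covering_design n h 2 X1 D1" and "resolution X1 D1 (P ` {1..p})"
    and "covering_design n h 2 X2 D2" and "resolution X2 D2 (R ` {1..p})"
    and "\<And>i. i \<in> {1..p} \<Longrightarrow> card (P i) = 2"
    and "\<And>i. i \<in> {1..p} \<Longrightarrow> card (R i) = 2"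
    and "covering_design n k 4 X1 B1"
    and "covering_design n k 4 X2 B2"
    and "B = B1 \<union> B2 \<union> (\<Union>i\<in>{1..p}. join (P i) (R i))"
  shows "cover v k 4 5 X B"
proof -
  note [simp] = \<open>B = _\<close>
  have D: "\<forall>A\<in>D1. A \<subseteq> X1 \<and> card A = h" "\<forall>C\<in>D2. C \<subseteq> X2 \<and> card C = h"
    using assms(13,15) by (auto simp: covering_design_def cover_def)
  have cov: "cover n k 4 4 X1 B1" "cover n k 4 4 X2 B2"
    using assms(19,20) by (auto simp: covering_design_def)
  have fin: "finite X1" "finite X2"
    using assms(7,9) by auto
  note class1 = resolution_class[OF assms(14)] and class2 = resolution_class[OF assms(16)]
  have two: "\<forall>i\<in>{1..p}. partition_on X1 (P i) \<and> card (P i) = 2"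
    "\<forall>i\<in>{1..p}. partition_on X2 (R i) \<and> card (R i) = 2"
    using class1(1) class2(1) assms(17,18) by blast+
  have "b \<subseteq> X \<and> card b = k" if "b \<in> B" for b
  proof -
    consider "b \<in> B1 \<union> B2" | i where "i \<in> {1..p}" "b \<in> join (P i) (R i)"
      using \<open>b \<in> B\<close> by auto
    then show ?thesis
    proof cases
      case 1
      then show ?thesis using cov assms(9) by (auto simp: cover_def)
    next
      case 2
      then obtain A C where b: "b = A \<union> C" and "A \<in> P i" "C \<in> R i"
        unfolding join_def by blast
      then have A: "A \<subseteq> X1" "card A = h" and C: "C \<subseteq> X2" "card C = h"
        using class1(2) class2(2) 2(1) D by blast+
      have "card b = card A + card C"
        unfolding b using A(1) C(1) fin assms(10)
        by (intro card_Un_disjoint) (auto intro: finite_subset)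
      \<comment> \<open>The evenness of \<open>k\<close> enters here: it gives
        \<open>h + h = k\<close>.\<close>
      then show ?thesis
        using A C b assms(3,6,9) by auto
    qed
  qed
  moreover have "\<exists>b\<in>B. 4 \<le> card (M \<inter> b)" if M: "M \<subseteq> X" "card M = 5" for M
  proof -
    have "M = (M \<inter> X1) \<union> (M \<inter> X2)"
      using M(1) assms(9) by auto
    then have "card M = card (M \<inter> X1) + card (M \<inter> X2)"
      using fin assms(10) card_Un_disjoint[of "M \<inter> X1" "M \<inter> X2"] by auto
    \<comment> \<open>The first two cases absorb the splits 5 + 0 and 4 + 1 in either order; only 3
      + 2 and 2 + 3 remain.\<close>
    then consider "4 \<le> card (M \<inter> X1)" | "4 \<le> card (M \<inter> X2)"
      | "3 \<le> card (M \<inter> X1)" "2 \<le> card (M \<inter> X2)"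
      | "3 \<le> card (M \<inter> X2)" "2 \<le> card (M \<inter> X1)"
      using M(2) by linarith
    then show ?thesis
    proof cases
      case 1
      then show ?thesis using cover_meets_superset[OF cov(1)] by auto
    next
      case 2
      then show ?thesis using cover_meets_superset[OF cov(2)] by auto
    next
      case 3
      then show ?thesis
        using join_block_meets_split[OF assms(15,16) two(1) fin(1) assms(10) 3]
        by auto
    next
      case 4
      \<comment> \<open>The mirror case exchanges the halves and so yields a block of
        \<open>join (R i) (P i)\<close>; commutativity of \<open>join\<close> places it in
        \<open>B\<close>.\<close>
      have "X2 \<inter> X1 = {}" using assms(10) by auto
      from join_block_meets_split[OF assms(13,14) two(2) fin(2) this 4]
      show ?thesis by (auto simp: join_commute[of "R _"])
    qed
  qed
  ultimately show ?thesis
    using assms(7,8) unfolding cover_def by blast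
qed

end
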